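(* Let $\Gamma$ be a graph with a vertex partition $\{C_1,\dots,C_5,D\}$, where the indices of the sets $C_i$ are read in $\mathbb{Z}/5\mathbb{Z}$, such that: (i) $|C_1|=\cdots=|C_5|=2$; write $C_i=\{v_{i1},v_{i2}\}$. (ii) For every vertex $v\in D$, the numbers of neighbours of $v$ in $C_1,\dots,C_5$ are all congruent modulo $2$. (iii) One of the following three cases holds (the same case for all $i\in\mathbb{Z}/5\mathbb{Z}$), where the listed sets are the edge sets of the induced subgraphs: (a) for all $i$: with $j=i+1$, $C_i\cup C_j$ has edge set $\emptyset$ or $\{v_{i1}v_{j1},v_{i1}v_{j2},v_{i2}v_{j1},v_{i2}v_{j2}\}$; and with $j=i+2$, $C_i\cup C_j$ has edge set $\{v_{i1}v_{j1},v_{i1}v_{j2}\}$ or $\{v_{i2}v_{j1},v_{i2}v_{j2}\}$. (b) for all $i$: with $j=i+1$, $C_i\cup C_j$ has edge set $\{v_{i1}v_{j1},v_{i2}v_{j2}\}$ or $\{v_{i1}v_{j2},v_{i2}v_{j1}\}$; and with $j=i+2$, $C_i\cup C_j$ has edge set $\{v_{i1}v_{j1},v_{i1}v_{j2}\}$ or $\{v_{i2}v_{j1},v_{i2}v_{j2}\}$. (c) for all $i$: with $j=i+1$, $C_i\cup C_j$ has edge set $\{v_{i1}v_{j1},v_{i1}v_{j2}\}$ or $\{v_{i2}v_{j1},v_{i2}v_{j2}\}$; and with $j=i+2$, $C_i\cup C_j$ has edge set $\{v_{i1}v_{j1},v_{i2}v_{j1}\}$ or $\{v_{i1}v_{j2},v_{i2}v_{j2}\}$.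 Let $\pi$ be the permutation of $C_1\cup\dots\cup C_5$ with $\pi(v_{ia})=v_{i-1,a}$. Construct $\Gamma'$ from $\Gamma$ on the same vertex set as follows, leaving all other adjacencies unchanged. For every $v\in D$ that has exactly one neighbour $w$ in each $C_i$, replace each such edge $\{v,w\}$ by $\{v,\pi(w)\}$. Moreover, according to the cases above, simultaneously for every $i\in\mathbb{Z}/5\mathbb{Z}$: (a) replace the induced subgraph on $C_i\cup C_{i+2}$ by the former induced subgraph on $C_i\cup C_{i+3}$; (b) replace the induced subgraph on $C_i\cup C_{i+1}$ by the former induced subgraph on $C_{i+1}\cup C_{i+2}$, and replace the induced subgraph on $C_i\cup C_{i+2}$ by the former induced subgraph on $C_i\cup C_{i+3}$; (c) replace the induced subgraph on $C_i\cup C_{i+1}$ by the former induced subgraph on $C_i\cup C_{i+2}$, and replace the induced subgraph on $C_i\cup C_{i+2}$ by the former induced subgraph on $C_{i+1}\cup C_{i+2}$. Then $\Gamma'$ is $\mathbb{R}$-cospectral with $\Gamma$.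
   Context: Graphs are finite, simple and loopless. Two graphs with adjacency matrices $A$ and $A'$ are $\mathbb{R}$-cospectral if $A+rJ$ and $A'+rJ$ have the same spectrum for every $r\in\mathbb{R}$, where $J$ is the all-ones matrix. "Replace the induced subgraph on $C_i\cup C_j$ by the former induced subgraph on $C_k\cup C_l$" means: in the new graph, $v_{ia}$ and $v_{jb}$ are adjacent if and only if $v_{ka}$ and $v_{lb}$ were adjacent in $\Gamma$ ($a,b\in\{1,2\}$); the sets $C_i$ themselves remain edgeless. *)

theory Defs
  imports
    "HOL-Library.Numeral_Type"
    "HOL-Number_Theory.Cong"
    "Graph_Theory.Graph_Theory"
    "Jordan_Normal_Form.Spectral_Radius"
begin

section \<open>Graphs, spectra and \<open>\<real>\<close>-cospectrality\<close>

text \<open>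
  A finite simple loopless graph is a \<^locale>\<open>pair_graph\<close>: an undirected edge \<open>{x, y}\<close> is
  represented by the two arcs \<open>(x, y)\<close> and \<open>(y, x)\<close>.
\<close>

definition vertex_listing :: "'a pair_pre_digraph \<Rightarrow> 'a list \<Rightarrow> bool" where
  "vertex_listing G vs \<longleftrightarrow> distinct vs \<and> set vs = pverts G"

definition adjacency_matrix :: "'a pair_pre_digraph \<Rightarrow> 'a list \<Rightarrow> real mat" where
  "adjacency_matrix G vs =
    mat (length vs) (length vs) (\<lambda>(p, q). if (vs ! p, vs ! q) \<in> parcs G then 1 else 0)"

definition all_ones :: "nat \<Rightarrow> real mat" where
  "all_ones n = mat n n (\<lambda>_. 1)"

text \<open>
  The spectrum with multiplicities. Passing to \<open>\<complex>\<close> ensures that no eigenvalue is lost.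
\<close>

definition mspectrum :: "real mat \<Rightarrow> complex multiset" where
  "mspectrum A = proots (char_poly (map_mat complex_of_real A))"

lemma set_mspectrum:
  assumes "A \<in> carrier_mat n n"
  shows "set_mset (mspectrum A) = spectrum (map_mat complex_of_real A)"
proof -
  have A: "map_mat complex_of_real A \<in> carrier_mat n n"
    using assms by simp
  have "monic (char_poly (map_mat complex_of_real A))"
    using degree_monic_char_poly[OF A] by simp
  then have "char_poly (map_mat complex_of_real A) \<noteq> 0"
    by auto
  then show ?thesis
    by (simp add: mspectrum_def spectrum_root_char_poly[OF A])
qed

lemma size_mspectrum:
  assumes "A \<in> carrier_mat n n"
  shows "size (mspectrum A) = n"
proof -
  have A: "map_mat complex_of_real A \<in> carrier_mat n n"
    using assms by simp
  show ?thesis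
    using degree_monic_char_poly[OF A] by (simp add: mspectrum_def size_proots_complex)
qed

text \<open>
  The spectrum does not depend on how the vertices are ordered, so the quantification over
  listings is only a way of avoiding an arbitrary choice; for finite graphs listings exist.
\<close>

definition R_cospectral :: "'a pair_pre_digraph \<Rightarrow> 'b pair_pre_digraph \<Rightarrow> bool" where
  "R_cospectral G H \<longleftrightarrow>
    (\<forall>vs ws. vertex_listing G vs \<longrightarrow> vertex_listing H ws \<longrightarrow>
      (\<forall>r :: real.
        mspectrum (adjacency_matrix G vs + r \<cdot>\<^sub>m all_ones (length vs)) =
        mspectrum (adjacency_matrix H ws + r \<cdot>\<^sub>m all_ones (length ws))))"

definition induced_edges :: "'a pair_pre_digraph \<Rightarrow> 'a set \<Rightarrow> 'a set set" where
  "induced_edges G S = {{x, y} | x y. x \<in> S \<and> y \<in> S \<and> (x, y) \<in> parcs G}"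

definition nbrs_in :: "'a pair_pre_digraph \<Rightarrow> 'a set \<Rightarrow> 'a \<Rightarrow> 'a set" where
  "nbrs_in G S x = {w \<in> S. (x, w) \<in> parcs G}"


section \<open>The switching operation\<close>

text \<open>
  The type \<open>5\<close> is the ring \<open>\<int>/5\<int>\<close>, so index arithmetic such as \<open>i + 2\<close> or \<open>i - 1\<close> is modulo 5.
  The type \<open>2\<close> serves as the set of labels \<open>{1, 2}\<close> (where \<open>2 = 0\<close>); no arithmetic is done in it.
\<close>

definition cell :: "(5 \<Rightarrow> 2 \<Rightarrow> 'a) \<Rightarrow> 5 \<Rightarrow> 'a set" where
  "cell v i = {v i 1, v i 2}"

datatype switching_case = Case_a | Case_b | Case_c

primrec switching_condition ::
  "switching_case \<Rightarrow> 'a pair_pre_digraph \<Rightarrow> (5 \<Rightarrow> 2 \<Rightarrow> 'a) \<Rightarrow> bool" where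
  "switching_condition Case_a G v \<longleftrightarrow> (\<forall>i.
    (let j = i + 1 in induced_edges G (cell v i \<union> cell v j) \<in>
      {{},
       {{v i 1, v j 1}, {v i 1, v j 2}, {v i 2, v j 1}, {v i 2, v j 2}}}) \<and>
    (let j = i + 2 in induced_edges G (cell v i \<union> cell v j) \<in>
      {{{v i 1, v j 1}, {v i 1, v j 2}},
       {{v i 2, v j 1}, {v i 2, v j 2}}}))"
| "switching_condition Case_b G v \<longleftrightarrow> (\<forall>i.
    (let j = i + 1 in induced_edges G (cell v i \<union> cell v j) \<in>
      {{{v i 1, v j 1}, {v i 2, v j 2}},
       {{v i 1, v j 2}, {v i 2, v j 1}}}) \<and>
    (let j = i + 2 in induced_edges G (cell v i \<union> cell v j) \<in>
      {{{v i 1, v j 1}, {v i 1, v j 2}},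
       {{v i 2, v j 1}, {v i 2, v j 2}}}))"
| "switching_condition Case_c G v \<longleftrightarrow> (\<forall>i.
    (let j = i + 1 in induced_edges G (cell v i \<union> cell v j) \<in>
      {{{v i 1, v j 1}, {v i 1, v j 2}},
       {{v i 2, v j 1}, {v i 2, v j 2}}}) \<and>
    (let j = i + 2 in induced_edges G (cell v i \<union> cell v j) \<in>
      {{{v i 1, v j 1}, {v i 2, v j 1}},
       {{v i 1, v j 2}, {v i 2, v j 2}}}))"

text \<open>
  \<open>((i, j), (k, l))\<close> means: the induced subgraph on \<open>C\<^sub>i \<union> C\<^sub>j\<close> is replaced by the former induced
  subgraph on \<open>C\<^sub>k \<union> C\<^sub>l\<close>.
\<close>

primrec replacements :: "switching_case \<Rightarrow> ((5 \<times> 5) \<times> (5 \<times> 5)) set" where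
  "replacements Case_a = {((i, i + 2), (i, i + 3)) | i. True}"
| "replacements Case_b =
    {((i, i + 1), (i + 1, i + 2)) | i. True} \<union> {((i, i + 2), (i, i + 3)) | i. True}"
| "replacements Case_c =
    {((i, i + 1), (i, i + 2)) | i. True} \<union> {((i, i + 2), (i + 1, i + 2)) | i. True}"

definition block_removed :: "switching_case \<Rightarrow> (5 \<Rightarrow> 2 \<Rightarrow> 'a) \<Rightarrow> 'a rel" where
  "block_removed c v =
    {(v i a, v j b) | i j k l a b. ((i, j), (k, l)) \<in> replacements c}"

definition block_added ::
  "switching_case \<Rightarrow> 'a pair_pre_digraph \<Rightarrow> (5 \<Rightarrow> 2 \<Rightarrow> 'a) \<Rightarrow> 'a rel" where
  "block_added c G v =
    {(v i a, v j b) | i j k l a b.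
      ((i, j), (k, l)) \<in> replacements c \<and> (v k a, v l b) \<in> parcs G}"

definition transversal_vertices ::
  "'a pair_pre_digraph \<Rightarrow> (5 \<Rightarrow> 2 \<Rightarrow> 'a) \<Rightarrow> 'a set \<Rightarrow> 'a set" where
  "transversal_vertices G v D = {x \<in> D. \<forall>i. card (nbrs_in G (cell v i) x) = 1}"

definition outer_removed ::
  "'a pair_pre_digraph \<Rightarrow> (5 \<Rightarrow> 2 \<Rightarrow> 'a) \<Rightarrow> 'a set \<Rightarrow> 'a rel" where
  "outer_removed G v D =
    {(x, v i a) | x i a. x \<in> transversal_vertices G v D \<and> (x, v i a) \<in> parcs G}"

text \<open>The permutation \<open>\<pi>\<close> sends \<open>v i a\<close> to \<open>v (i - 1) a\<close>.\<close>

definition outer_added ::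
  "'a pair_pre_digraph \<Rightarrow> (5 \<Rightarrow> 2 \<Rightarrow> 'a) \<Rightarrow> 'a set \<Rightarrow> 'a rel" where
  "outer_added G v D =
    {(x, v (i - 1) a) | x i a. x \<in> transversal_vertices G v D \<and> (x, v i a) \<in> parcs G}"

text \<open>
  All removals and additions refer to the original graph, and each unordered pair is treated in
  both directions.
\<close>

definition switched ::
  "switching_case \<Rightarrow> 'a pair_pre_digraph \<Rightarrow> (5 \<Rightarrow> 2 \<Rightarrow> 'a) \<Rightarrow> 'a set \<Rightarrow> 'a pair_pre_digraph" where
  "switched c G v D =
    (let R = block_removed c v \<union> outer_removed G v D;
         N = block_added c G v \<union> outer_added G v D
     in G\<lparr>parcs := (parcs G - (R \<union> R\<inverse>)) \<union> (N \<union> N\<inverse>)\<rparr>)"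

lemma pverts_switched [simp]: "pverts (switched c G v D) = pverts G"
  by (simp add: switched_def Let_def)

lemma pair_graph_switched:
  fixes G :: "'a pair_pre_digraph" and v :: "5 \<Rightarrow> 2 \<Rightarrow> 'a"
  assumes "pair_graph G"
    and verts: "pverts G = (\<Union>i. cell v i) \<union> D"
    and disj: "\<And>i j. i \<noteq> j \<Longrightarrow> cell v i \<inter> cell v j = {}"
    and disjD: "\<And>i. cell v i \<inter> D = {}"
  shows "pair_graph (switched c G v D)"
proof -
  interpret pair_graph G by fact
  have two: "a = 1 \<or> a = 2" for a :: 2
  proof (induct a)
    case (of_int z)
    then have "z = 0 \<or> z = 1"
      by fastforce
    then show ?case
      by auto
  qed
  have in_cell: "v i a \<in> cell v i" for i a
    using two[of a] by (auto simp: cell_def)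
  have cell_eq: "i = j" if "v i a = v j b" for i j a b
    using disj[of i j] in_cell[of i a] in_cell[of j b] that by auto
  have in_verts: "v i a \<in> pverts G" for i a
    using in_cell[of i a] verts by auto
  have notD: "v i a \<notin> D" for i a
    using in_cell[of i a] disjD[of i] by auto
  have shift: "i \<noteq> i + 1" "i \<noteq> i + 2" for i :: 5
    by simp_all
  have repl: "i \<noteq> j" if "((i, j), kl) \<in> replacements c" for i j kl
    using that shift by (cases c) auto
  define R where "R = block_removed c v \<union> outer_removed G v D"
  define N where "N = block_added c G v \<union> outer_added G v D"
  have arcs: "parcs (switched c G v D) = (parcs G - (R \<union> R\<inverse>)) \<union> (N \<union> N\<inverse>)"
    by (simp add: switched_def R_def N_def Let_def)
  have N: "x \<in> pverts G \<and> y \<in> pverts G \<and> x \<noteq> y" if "(x, y) \<in> N" for x y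
    using that unfolding N_def
  proof
    assume "(x, y) \<in> block_added c G v"
    then show ?thesis
      using repl cell_eq in_verts by (fastforce simp: block_added_def)
  next
    assume "(x, y) \<in> outer_added G v D"
    then show ?thesis
      using in_verts notD verts by (auto simp: outer_added_def transversal_vertices_def)
  qed
  have G: "x \<in> pverts G \<and> y \<in> pverts G \<and> x \<noteq> y \<and> (y, x) \<in> parcs G"
    if "(x, y) \<in> parcs G" for x y
    using that arc_fst_in_verts[OF that] arc_snd_in_verts[OF that] pair_no_loops[OF that]
      pair_sym_arcs by (auto simp: symmetric_def dest: symD)
  have all: "x \<in> pverts G \<and> y \<in> pverts G \<and> x \<noteq> y \<and> (y, x) \<in> parcs (switched c G v D)"
    if "(x, y) \<in> parcs (switched c G v D)" for x y
    using that N G unfolding arcs by blast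
  have "finite (parcs (switched c G v D))"
    by (rule finite_subset[of _ "pverts G \<times> pverts G"]) (use all in auto)
  moreover have "sym (parcs (switched c G v D))"
    using all by (auto intro: symI)
  ultimately show ?thesis
    by unfold_locales (use all in \<open>auto simp: symmetric_def\<close>)
qed

end

theory Submission
  imports Defs
begin

text \<open>
  Let \<open>e = J/2\<close> and \<open>f = I - J/2\<close> be the \<open>2 \<times> 2\<close> projections onto constant and onto alternating
  vectors. The matrix \<open>Q\<close> that is the identity on \<open>D\<close> and \<open>e \<otimes> I + f \<otimes> P\<close> on the cells, for a
  cyclic shift \<open>P\<close> of order 5, is orthogonal with all row and column sums 1, so it commutes
  with \<open>J\<close>. For \<open>R\<close>-cospectrality it therefore suffices that \<open>A Q = Q A'\<close>. A vertex of \<open>D\<close> has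
  either only constant vectors on the cells, which \<open>Q\<close> fixes, or only vectors with entries 0 and 1
  and mean \<open>1/2\<close>, which \<open>Q\<close> shifts by one cell. Between two cells, each block of \<open>A\<close> is a
  constant block plus at most one block of pure type \<open>f _ e\<close>, \<open>e _ f\<close> or \<open>f _ f\<close>, and \<open>Q\<close> moves
  these pure parts by shifting only the indices on the \<open>f\<close> sides.
\<close>

section \<open>Cospectrality from an orthogonal intertwining matrix\<close>

lemma sum_nth_distinct:
  fixes f :: "'a \<Rightarrow> 'b :: comm_monoid_add"
  assumes "distinct xs" "set xs = V"
  shows "(\<Sum>k = 0..<length xs. f (xs ! k)) = sum f V"
  using sum.reindex_bij_betw[OF bij_betw_nth[of xs "{0..<length xs}" V], of f] assms
  by (simp add: atLeast0LessThan)

lemma mspectrum_eq_if_similar: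
  assumes "similar_mat A B"
  shows "mspectrum A = mspectrum B"
proof -
  obtain n where "A \<in> carrier_mat n n" "B \<in> carrier_mat n n"
    using similar_matD[OF assms] by auto
  then show ?thesis
    using char_poly_similar[OF assms] by (simp add: mspectrum_def of_real_hom.char_poly_hom)
qed

text \<open>Orthogonality turns the intertwining relation into a similarity, with the transpose as
  inverse. Working with functions on \<open>V\<close> keeps the later computations free of vertex
  orderings.\<close>

lemma mspectrum_eq_if_intertwined:
  fixes A B Q :: "'a \<Rightarrow> 'a \<Rightarrow> real"
  assumes vs: "distinct vs" "set vs = V" and ws: "distinct ws" "set ws = V"
    and orth: "\<And>x z. x \<in> V \<Longrightarrow> z \<in> V \<Longrightarrow> (\<Sum>y\<in>V. Q x y * Q z y) = of_bool (x = z)"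
    and twine: "\<And>x z. x \<in> V \<Longrightarrow> z \<in> V \<Longrightarrow> (\<Sum>y\<in>V. A x y * Q y z) = (\<Sum>y\<in>V. Q x y * B y z)"
  shows "mspectrum (mat (length vs) (length vs) (\<lambda>(p, q). A (vs ! p) (vs ! q))) =
    mspectrum (mat (length ws) (length ws) (\<lambda>(p, q). B (ws ! p) (ws ! q)))"
proof -
  define n where "n = length vs"
  have n: "length vs = n" "length ws = n"
    using vs ws distinct_card[of vs] distinct_card[of ws] by (simp_all add: n_def)
  \<comment> \<open>Rows follow \<open>vs\<close> and columns follow \<open>ws\<close>, so the
    change of vertex order is absorbed into the similarity.\<close>
  define P where "P = mat n n (\<lambda>(p, q). Q (vs ! p) (ws ! q))"
  define A' where "A' = mat n n (\<lambda>(p, q). A (vs ! p) (vs ! q))"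
  define B' where "B' = mat n n (\<lambda>(p, q). B (ws ! p) (ws ! q))"
  have carr: "P \<in> carrier_mat n n" "A' \<in> carrier_mat n n" "B' \<in> carrier_mat n n"
      "transpose_mat P \<in> carrier_mat n n"
    by (simp_all add: P_def A'_def B'_def)
  have V: "vs ! p \<in> V" "ws ! p \<in> V" if "p < n" for p
    using nth_mem[of p vs] nth_mem[of p ws] vs(2) ws(2) n that by metis+
  have sum_vs: "(\<Sum>k = 0..<n. f (vs ! k)) = sum f V"
    and sum_ws: "(\<Sum>k = 0..<n. f (ws ! k)) = sum f V" for f :: "'a \<Rightarrow> real"
    using sum_nth_distinct[OF vs, of f] sum_nth_distinct[OF ws, of f] n by simp_all
  have orth': "P * transpose_mat P = 1\<^sub>m n"
  proof (rule eq_matI)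
    fix p q assume "p < dim_row (1\<^sub>m n :: real mat)" "q < dim_col (1\<^sub>m n :: real mat)"
    then have pq: "p < n" "q < n"
      by simp_all
    then have "(P * transpose_mat P) $$ (p, q) = (\<Sum>y\<in>V. Q (vs ! p) y * Q (vs ! q) y)"
      by (simp add: P_def scalar_prod_def sum_ws[symmetric])
    also have "\<dots> = of_bool (p = q)"
      using pq vs n by (simp add: orth V nth_eq_iff_index_eq)
    finally show "(P * transpose_mat P) $$ (p, q) = 1\<^sub>m n $$ (p, q)"
      using pq by simp
  qed (simp_all add: P_def)
  have twine': "A' * P = P * B'"
  proof (rule eq_matI)
    fix p q assume "p < dim_row (P * B')" "q < dim_col (P * B')"
    then have pq: "p < n" "q < n"
      by (simp_all add: P_def B'_def)
    then show "(A' * P) $$ (p, q) = (P * B') $$ (p, q)"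
      using twine[of "vs ! p" "ws ! q"] V
      by (simp add: P_def A'_def B'_def scalar_prod_def
          flip: sum_vs[of "\<lambda>y. A (vs ! p) y * Q y (ws ! q)"] sum_ws[of "\<lambda>y. Q (vs ! p) y * B y (ws ! q)"])
  qed (simp_all add: P_def A'_def B'_def)
  have "A' = A' * (P * transpose_mat P)"
    using carr by (simp add: orth')
  also have "\<dots> = P * B' * transpose_mat P"
    using assoc_mult_mat[OF carr(2,1,4)] by (simp only: twine')
  finally have "similar_mat A' B'"
    using carr orth' mat_mult_left_right_inverse[OF carr(1,4) orth']
    by (intro similar_matI[of _ _ P "transpose_mat P" n]) auto
  then show ?thesis
    by (simp add: A'_def B'_def n mspectrum_eq_if_similar)
qed

text \<open>Row and column sums 1 give \<open>J Q = J = Q J\<close>, so intertwining of the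
  adjacency matrices extends to \<open>A + r J\<close> for every \<open>r\<close> with the same
  \<open>Q\<close>.\<close>

lemma R_cospectral_if_intertwined:
  fixes G H :: "'a pair_pre_digraph" and Q :: "'a \<Rightarrow> 'a \<Rightarrow> real"
  assumes verts: "pverts H = pverts G"
    and orth: "\<And>x z. x \<in> pverts G \<Longrightarrow> z \<in> pverts G \<Longrightarrow>
      (\<Sum>y\<in>pverts G. Q x y * Q z y) = of_bool (x = z)"
    and rows: "\<And>x. x \<in> pverts G \<Longrightarrow> (\<Sum>y\<in>pverts G. Q x y) = 1"
    and cols: "\<And>z. z \<in> pverts G \<Longrightarrow> (\<Sum>y\<in>pverts G. Q y z) = 1"
    and twine: "\<And>x z. x \<in> pverts G \<Longrightarrow> z \<in> pverts G \<Longrightarrow>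
      (\<Sum>y\<in>pverts G. of_bool ((x, y) \<in> parcs G) * Q y z) =
      (\<Sum>y\<in>pverts G. Q x y * of_bool ((y, z) \<in> parcs H))"
  shows "R_cospectral G H"
  unfolding R_cospectral_def vertex_listing_def
proof (intro allI impI)
  fix vs ws :: "'a list" and r :: real
  assume vs: "distinct vs \<and> set vs = pverts G" and ws: "distinct ws \<and> set ws = pverts H"
  define M :: "'a pair_pre_digraph \<Rightarrow> 'a \<Rightarrow> 'a \<Rightarrow> real"
    where "M K x y = of_bool ((x, y) \<in> parcs K) + r" for K x y
  have "(\<Sum>y\<in>pverts G. M G x y * Q y z) = (\<Sum>y\<in>pverts G. Q x y * M H y z)"
    if "x \<in> pverts G" "z \<in> pverts G" for x z
    using twine[OF that] rows[OF that(1)] cols[OF that(2)]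
    by (simp add: M_def algebra_simps sum.distrib flip: sum_distrib_left)
  moreover have "adjacency_matrix K xs + r \<cdot>\<^sub>m all_ones (length xs) =
      mat (length xs) (length xs) (\<lambda>(p, q). M K (xs ! p) (xs ! q))" for K xs
    by (rule eq_matI) (simp_all add: adjacency_matrix_def all_ones_def M_def)
  ultimately show "mspectrum (adjacency_matrix G vs + r \<cdot>\<^sub>m all_ones (length vs)) =
      mspectrum (adjacency_matrix H ws + r \<cdot>\<^sub>m all_ones (length ws))"
    using mspectrum_eq_if_intertwined[of vs "pverts G" ws Q "M G" "M H"] vs ws verts orth by simp
qed

section \<open>Arithmetic of labels and cell indices\<close>

lemma UNIV_2: "(UNIV :: 2 set) = {1, 2}"
  by (rule sym, rule card_subset_eq) simp_all

lemma cases_2: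
  fixes a :: 2
  obtains "a = 1" | "a = 2"
  using UNIV_2 by blast

text \<open>As a rewrite rule this leaves \<open>1\<close> as the only label in comparisons, so that
  complementary conditions are recognised as negations of each other.\<close>

lemma eq_2_iff: "a = (2 :: 2) \<longleftrightarrow> a \<noteq> 1"
  by (rule cases_2[of a]) simp_all

lemma sum_2: "(\<Sum>a\<in>UNIV. f a) = f (1 :: 2) + f 2"
  by (simp add: UNIV_2)

lemma eq_if_neq_1: "a \<noteq> 1 \<Longrightarrow> b \<noteq> 1 \<Longrightarrow> a = (b :: 2)"
  by (metis eq_2_iff)

lemma cases_5:
  fixes i j :: 5
  obtains "j = i" | "j = i + 1" | "j = i + 2" | "j = i + 3" | "j = i + 4"
proof -
  have "{0, 1, 2, 3, 4 :: 5} = UNIV"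
    by (rule card_subset_eq) simp_all
  then have "j - i \<in> {0, 1, 2, 3, 4}"
    by simp
  then show ?thesis
    using that by (auto simp: algebra_simps)
qed

lemma numeral_5_reduce [simp]:
  "(5 :: 5) = 0" "(6 :: 5) = 1" "(7 :: 5) = 2" "(8 :: 5) = 3" "(9 :: 5) = 4"
  by simp_all

section \<open>Intertwining of the blocks between cells\<close>

text \<open>
  The entries of \<open>E Q = Q F\<close> at rows of cell \<open>i + 1\<close> and columns of cell \<open>j\<close>.
\<close>

definition blocks_intertwined ::
  "(5 \<Rightarrow> 2 \<Rightarrow> 5 \<Rightarrow> 2 \<Rightarrow> bool) \<Rightarrow> (5 \<Rightarrow> 2 \<Rightarrow> 5 \<Rightarrow> 2 \<Rightarrow> bool) \<Rightarrow> bool" where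
  "blocks_intertwined E F \<longleftrightarrow> (\<forall>i a j b.
    (of_bool (E (i + 1) a j 1) + of_bool (E (i + 1) a j 2)) / 2 +
    of_bool (E (i + 1) a (j + 1) b) -
    (of_bool (E (i + 1) a (j + 1) 1) + of_bool (E (i + 1) a (j + 1) 2)) / 2 =
    (of_bool (F (i + 1) 1 j b) + of_bool (F (i + 1) 2 j b)) / 2 +
    of_bool (F i a j b) -
    (of_bool (F i 1 j b) + of_bool (F i 2 j b)) / (2 :: real))"

context
  fixes E F :: "5 \<Rightarrow> 2 \<Rightarrow> 5 \<Rightarrow> 2 \<Rightarrow> bool"
  assumes E_diag: "\<And>i a b. \<not> E i a i b" and F_diag: "\<And>i a b. \<not> F i a i b"
    and E_sym: "\<And>i a j b. E i a j b \<longleftrightarrow> E j b i a"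
    and F_sym: "\<And>i a j b. F i a j b \<longleftrightarrow> F j b i a"
begin

text \<open>Distance 1 blocks are constant and stay fixed. The block from cell \<open>i\<close> to
  cell \<open>i + 2\<close> is constant plus a part of type \<open>f _ e\<close>, whose row index
  moves to \<open>i - 1\<close>. The distance becomes 3, which is what \<open>F2\<close> says. Here
  \<open>t i\<close> is the label of the vertex of cell \<open>i\<close> joined to all of cell
  \<open>i + 2\<close>.\<close>

lemma blocks_intertwined_case_a:
  fixes c :: "5 \<Rightarrow> bool" and t :: "5 \<Rightarrow> 2"
  assumes E1: "\<And>i a b. E i a (i + 1) b \<longleftrightarrow> c i"
    and E2: "\<And>i a b. E i a (i + 2) b \<longleftrightarrow> a = t i"
    and F1: "\<And>i a b. F i a (i + 1) b \<longleftrightarrow> E i a (i + 1) b"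
    and F2: "\<And>i a b. F i a (i + 2) b \<longleftrightarrow> E i a (i + 3) b"
  shows "blocks_intertwined E F"
proof -
  \<comment> \<open>Symmetry yields distances 3 and 4 from distances 2 and 1. With the distance as a
    premise, the rules apply however the two indices are written.\<close>
  have E: "l = k + 1 \<Longrightarrow> E k a l b \<longleftrightarrow> c k"
      "l = k + 2 \<Longrightarrow> E k a l b \<longleftrightarrow> a = t k"
      "l = k + 3 \<Longrightarrow> E k a l b \<longleftrightarrow> b = t l"
      "l = k + 4 \<Longrightarrow> E k a l b \<longleftrightarrow> c l" for k l a b
    using E1[of k a b] E2[of k a b] E1[of l b a] E2[of l b a] E_sym[of k a l b] by auto
  \<comment> \<open>From cell \<open>k + 3\<close> it is two steps on to cell \<open>k\<close>, so
    the old block between \<open>k\<close> and \<open>k + 3\<close> is governed by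
    \<open>t (k + 3)\<close>.\<close>
  have F: "l = k + 1 \<Longrightarrow> F k a l b \<longleftrightarrow> c k"
      "l = k + 2 \<Longrightarrow> F k a l b \<longleftrightarrow> b = t (k + 3)"
      "l = k + 3 \<Longrightarrow> F k a l b \<longleftrightarrow> a = t (l + 3)"
      "l = k + 4 \<Longrightarrow> F k a l b \<longleftrightarrow> c l" for k l a b
    using F1[of k a b] F2[of k a b] F1[of l b a] F2[of l b a] F_sym[of k a l b] by (auto simp: E)
  show ?thesis
    unfolding blocks_intertwined_def
  proof (intro allI, goal_cases)
    case (1 i a j b)
    show ?case
      \<comment> \<open>Five index differences and four label pairs remain, each an identity between
        truth values of \<open>c\<close> and \<open>t\<close>.\<close>
      by (rule cases_5[of j i]; rule cases_2[of a]; rule cases_2[of b])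
        (simp_all add: E F E_diag F_diag eq_2_iff ac_simps)
  qed
qed

text \<open>A perfect matching is constant plus a part of type \<open>f _ f\<close>, so both of its
  indices shift and distance 1 is preserved. Distance 2 blocks behave as in the first case.\<close>

lemma blocks_intertwined_case_b:
  fixes c :: "5 \<Rightarrow> bool" and t :: "5 \<Rightarrow> 2"
  assumes E1: "\<And>i a b. E i a (i + 1) b \<longleftrightarrow> (a = b) = c i"
    and E2: "\<And>i a b. E i a (i + 2) b \<longleftrightarrow> a = t i"
    and F1: "\<And>i a b. F i a (i + 1) b \<longleftrightarrow> E (i + 1) a (i + 2) b"
    and F2: "\<And>i a b. F i a (i + 2) b \<longleftrightarrow> E i a (i + 3) b"
  shows "blocks_intertwined E F"
proof -
  have E: "l = k + 1 \<Longrightarrow> E k a l b \<longleftrightarrow> (a = b) = c k"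
      "l = k + 2 \<Longrightarrow> E k a l b \<longleftrightarrow> a = t k"
      "l = k + 3 \<Longrightarrow> E k a l b \<longleftrightarrow> b = t l"
      "l = k + 4 \<Longrightarrow> E k a l b \<longleftrightarrow> (a = b) = c l" for k l a b
    using E1[of k a b] E2[of k a b] E1[of l b a] E2[of l b a] E_sym[of k a l b] by auto
  have F: "l = k + 1 \<Longrightarrow> F k a l b \<longleftrightarrow> (a = b) = c (k + 1)"
      "l = k + 2 \<Longrightarrow> F k a l b \<longleftrightarrow> b = t (k + 3)"
      "l = k + 3 \<Longrightarrow> F k a l b \<longleftrightarrow> a = t (l + 3)"
      "l = k + 4 \<Longrightarrow> F k a l b \<longleftrightarrow> (a = b) = c (l + 1)" for k l a b
    using F1[of k a b] F2[of k a b] F1[of l b a] F2[of l b a] F_sym[of k a l b] by (auto simp: E)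
  show ?thesis
    unfolding blocks_intertwined_def
  proof (intro allI, goal_cases)
    case (1 i a j b)
    show ?case
      by (rule cases_5[of j i]; rule cases_2[of a]; rule cases_2[of b])
        (simp_all add: E F E_diag F_diag eq_2_iff ac_simps)
  qed
qed

text \<open>Distance 1 blocks have a part of type \<open>f _ e\<close>, whose row shift produces
  distance 2. Distance 2 blocks have a part of type \<open>e _ f\<close>, whose column shift
  produces distance 1. The two families are thus exchanged.\<close>

lemma blocks_intertwined_case_c:
  fixes t u :: "5 \<Rightarrow> 2"
  assumes E1: "\<And>i a b. E i a (i + 1) b \<longleftrightarrow> a = t i"
    and E2: "\<And>i a b. E i a (i + 2) b \<longleftrightarrow> b = u i"
    and F1: "\<And>i a b. F i a (i + 1) b \<longleftrightarrow> E i a (i + 2) b"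
    and F2: "\<And>i a b. F i a (i + 2) b \<longleftrightarrow> E (i + 1) a (i + 2) b"
  shows "blocks_intertwined E F"
proof -
  have E: "l = k + 1 \<Longrightarrow> E k a l b \<longleftrightarrow> a = t k"
      "l = k + 2 \<Longrightarrow> E k a l b \<longleftrightarrow> b = u k"
      "l = k + 3 \<Longrightarrow> E k a l b \<longleftrightarrow> a = u l"
      "l = k + 4 \<Longrightarrow> E k a l b \<longleftrightarrow> b = t l" for k l a b
    using E1[of k a b] E2[of k a b] E1[of l b a] E2[of l b a] E_sym[of k a l b] by auto
  have F: "l = k + 1 \<Longrightarrow> F k a l b \<longleftrightarrow> b = u k"
      "l = k + 2 \<Longrightarrow> F k a l b \<longleftrightarrow> a = t (k + 1)"
      "l = k + 3 \<Longrightarrow> F k a l b \<longleftrightarrow> b = t (l + 1)"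
      "l = k + 4 \<Longrightarrow> F k a l b \<longleftrightarrow> a = u l" for k l a b
    using F1[of k a b] F2[of k a b] F1[of l b a] F2[of l b a] F_sym[of k a l b] by (auto simp: E)
  show ?thesis
    unfolding blocks_intertwined_def
  proof (intro allI, goal_cases)
    case (1 i a j b)
    show ?case
      by (rule cases_5[of j i]; rule cases_2[of a]; rule cases_2[of b])
        (simp_all add: E F E_diag F_diag eq_2_iff ac_simps)
  qed
qed

end

section \<open>The orthogonal matrix and its action on vectors\<close>

text \<open>
  On the cells this is \<open>e\<close> in block \<open>(i, i)\<close> and \<open>f\<close> in block \<open>(i + 1, i)\<close>, where \<open>f\<close> has the
  entries \<open>1/2\<close> and \<open>- 1/2\<close>.
\<close>

definition switch_weight :: "(5 \<Rightarrow> 2 \<Rightarrow> 'a) \<Rightarrow> 'a \<Rightarrow> 'a \<Rightarrow> real" where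
  "switch_weight v x y =
    (if x \<in> range (case_prod v) \<and> y \<in> range (case_prod v)
     then let (i, a) = inv_into UNIV (case_prod v) x; (j, b) = inv_into UNIV (case_prod v) y
       in (of_bool (i = j) + of_bool (i = j + 1) * (if a = b then 1 else - 1)) / 2
     else of_bool (x = y))"

text \<open>Injectivity of \<open>v\<close> in both arguments expresses at once that the cells are
  disjoint and have two elements each.\<close>

locale paired_cells =
  fixes v :: "5 \<Rightarrow> 2 \<Rightarrow> 'a" and D :: "'a set"
  assumes v_eq_iff [simp]: "v i a = v j b \<longleftrightarrow> i = j \<and> a = b"
    and v_notin [simp]: "v i a \<notin> D"
    and finite_D [simp]: "finite D"
begin

abbreviation "V \<equiv> range (case_prod v) \<union> D"

abbreviation "Q \<equiv> switch_weight v"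

text \<open>The value on cell \<open>i\<close> of the projection onto vectors constant on cells;
  subtracting it leaves the alternating part.\<close>

definition avg :: "('a \<Rightarrow> real) \<Rightarrow> 5 \<Rightarrow> real" where
  "avg f i = (f (v i 1) + f (v i 2)) / 2"

lemma inj_v: "inj (case_prod v)"
  by (auto simp: inj_def)

lemma Q_v_v:
  "Q (v i a) (v j b) = (of_bool (i = j) + of_bool (i = j + 1) * (if a = b then 1 else - 1)) / 2"
proof -
  have "v i a = case_prod v (i, a)" "v j b = case_prod v (j, b)"
    by simp_all
  then show ?thesis
    unfolding switch_weight_def by (simp only: inv_f_f[OF inj_v] rangeI) simp
qed

lemma Q_D [simp]:
  "x \<in> D \<Longrightarrow> Q x y = of_bool (x = y)" "y \<in> D \<Longrightarrow> Q x y = of_bool (x = y)"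
  by (auto simp: switch_weight_def split: prod.splits)

lemma sum_V:
  "sum f V = (\<Sum>i\<in>UNIV. f (v i 1) + f (v i 2)) + sum f D" for f :: "'a \<Rightarrow> real"
proof -
  have "sum f V = sum f (range (case_prod v)) + sum f D"
    by (rule sum.union_disjoint) auto
  also have "sum f (range (case_prod v)) = (\<Sum>p\<in>UNIV. f (case_prod v p))"
    by (simp only: sum.reindex[OF inj_v] o_def)
  also have "\<dots> = (\<Sum>(i, a)\<in>UNIV \<times> UNIV. f (v i a))"
    by (simp add: case_prod_beta)
  also have "\<dots> = (\<Sum>i\<in>UNIV. f (v i 1) + f (v i 2))"
    by (simp only: sum_2 flip: sum.cartesian_product UNIV_Times_UNIV)
  finally show ?thesis .
qed

lemma V_cases [consumes 1, case_names cell outer]: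
  assumes "x \<in> V"
  obtains i a where "x = v i a" | "x \<in> D"
  using assms by auto

text \<open>Column \<open>v j b\<close> of \<open>Q\<close> has \<open>e\<close> in cell
  \<open>j\<close> and \<open>f\<close> in cell \<open>j + 1\<close>: it keeps the mean of cell
  \<open>j\<close> and adds the deviation from the mean in cell \<open>j + 1\<close>.\<close>

lemma sum_Q_right_v:
  "(\<Sum>y\<in>V. f y * Q y (v j b)) = avg f j + f (v (j + 1) b) - avg f (j + 1)"
proof -
  have "f (v i 1) * Q (v i 1) (v j b) + f (v i 2) * Q (v i 2) (v j b) =
      (if i = j then avg f j else 0) + (if i = j + 1 then f (v (j + 1) b) - avg f (j + 1) else 0)" for i
    by (rule cases_2[of b]) (auto simp: Q_v_v avg_def field_simps)
  moreover have "(\<Sum>y\<in>D. f y * Q y (v j b)) = 0"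
    by (rule sum.neutral) auto
  ultimately show ?thesis
    unfolding sum_V by (simp add: sum.distrib)
qed

text \<open>From the left the shift is reversed: row \<open>v i a\<close> has its \<open>f\<close>
  part in cell \<open>i - 1\<close>.\<close>

lemma sum_Q_left_v:
  "(\<Sum>y\<in>V. Q (v i a) y * f y) = avg f i + f (v (i - 1) a) - avg f (i - 1)"
proof -
  have "Q (v i a) (v j 1) * f (v j 1) + Q (v i a) (v j 2) * f (v j 2) =
      (if j = i then avg f i else 0) + (if j = i - 1 then f (v (i - 1) a) - avg f (i - 1) else 0)" for j
    by (rule cases_2[of a]) (auto simp: Q_v_v avg_def field_simps)
  moreover have "(\<Sum>y\<in>D. Q (v i a) y * f y) = 0"
    by (rule sum.neutral) auto
  ultimately show ?thesis
    unfolding sum_V by (simp add: sum.distrib)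
qed

lemma sum_Q_right_D: "z \<in> D \<Longrightarrow> (\<Sum>y\<in>V. f y * Q y z) = f z"
  by simp

lemma sum_Q_left_D: "x \<in> D \<Longrightarrow> (\<Sum>y\<in>V. Q x y * f y) = f x"
  by simp

text \<open>Since \<open>e\<close> and \<open>f\<close> are complementary orthogonal projections and
  the shift is a permutation, the mixed terms vanish and the product with the transpose is
  \<open>e + f = I\<close> on the cells. The computation applies \<open>sum_Q_left_v\<close> to row
  \<open>z\<close> of \<open>Q\<close>.\<close>

lemma Q_orth:
  assumes "x \<in> V" "z \<in> V"
  shows "(\<Sum>y\<in>V. Q x y * Q z y) = of_bool (x = z)"
  using assms(1)
proof (cases x rule: V_cases)
  case (cell i a)
  show ?thesis
    using assms(2)
  proof (cases z rule: V_cases)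
    case (cell k c)
    show ?thesis
      unfolding \<open>x = v i a\<close> \<open>z = v k c\<close> sum_Q_left_v avg_def
      by (rule cases_2[of a]; rule cases_2[of c]) (auto simp: Q_v_v)
  qed (use cell in \<open>auto simp: sum_Q_left_v avg_def\<close>)
qed (simp add: sum_Q_left_D eq_commute)

text \<open>\<open>Q\<close> is the identity on \<open>D\<close>, and \<open>blocks\<close> covers
  pairs of cells. Towards the cells, a vertex of \<open>D\<close> of the first kind has no
  alternating part; one of the second kind has mean 1/2 on every cell, so the means cancel and only
  the shifted entry survives.\<close>

lemma intertwined_if_blocks:
  fixes A B :: "'a \<Rightarrow> 'a \<Rightarrow> bool"
  assumes A_sym: "\<And>x y. A x y \<longleftrightarrow> A y x" and B_sym: "\<And>x y. B x y \<longleftrightarrow> B y x"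
    and inner: "\<And>x y. x \<in> D \<Longrightarrow> y \<in> D \<Longrightarrow> B x y \<longleftrightarrow> A x y"
    and outer: "\<And>x. x \<in> D \<Longrightarrow>
      (\<forall>i. A x (v i 1) = A x (v i 2)) \<and> (\<forall>i a. B x (v i a) = A x (v i a)) \<or>
      (\<forall>i. A x (v i 1) \<noteq> A x (v i 2)) \<and> (\<forall>i a. B x (v i a) = A x (v (i + 1) a))"
    and blocks: "blocks_intertwined (\<lambda>i a j b. A (v i a) (v j b)) (\<lambda>i a j b. B (v i a) (v j b))"
    and "x \<in> V" "z \<in> V"
  shows "(\<Sum>y\<in>V. of_bool (A x y) * Q y z) = (\<Sum>y\<in>V. Q x y * of_bool (B y z))"
  using \<open>x \<in> V\<close>
proof (cases x rule: V_cases)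
  case x: (cell i a)
  show ?thesis
    using \<open>z \<in> V\<close>
  proof (cases z rule: V_cases)
    case z: (cell j b)
    show ?thesis
      using blocks[unfolded blocks_intertwined_def, rule_format, of "i - 1" a j b]
      unfolding x z sum_Q_right_v sum_Q_left_v avg_def by simp
  next
    case z: outer
    \<comment> \<open>The left sum reads \<open>B\<close> at cell \<open>i - 1\<close>, which in the
      second alternative is \<open>A\<close> at cell \<open>i\<close>.\<close>
    show ?thesis
      using outer[OF z]
      unfolding x sum_Q_right_D[OF z] sum_Q_left_v avg_def
      by (cases a rule: cases_2) (auto simp: A_sym[of _ z] B_sym[of _ z])
  qed
next
  case x: outer
  show ?thesis
    using \<open>z \<in> V\<close>
  proof (cases z rule: V_cases)
    case z: (cell j b)
    show ?thesis
      using outer[OF x]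
      unfolding z sum_Q_right_v sum_Q_left_D[OF x] avg_def
      by (cases b rule: cases_2) auto
  next
    case outer
    then show ?thesis
      unfolding sum_Q_right_D[OF outer] sum_Q_left_D[OF x] by (simp add: inner[OF x])
  qed
qed

end

section \<open>Adjacency in the switched graph\<close>

locale switching = pair_graph \<Gamma> + paired_cells v D
  for \<Gamma> :: "'a pair_pre_digraph" and v :: "5 \<Rightarrow> 2 \<Rightarrow> 'a" and D :: "'a set" and c :: switching_case +
  assumes parity: "\<And>x i j. x \<in> D \<Longrightarrow>
      [card (nbrs_in \<Gamma> (cell v i) x) = card (nbrs_in \<Gamma> (cell v j) x)] (mod 2)"
    and condition: "switching_condition c \<Gamma> v"
begin

abbreviation "A x y \<equiv> (x, y) \<in> parcs \<Gamma>"

abbreviation "A' x y \<equiv> (x, y) \<in> parcs (switched c \<Gamma> v D)"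

lemma A_sym: "A x y \<longleftrightarrow> A y x"
  using pair_sym_arcs by (auto simp: symmetric_def dest: symD)

lemma A'_sym: "A' x y \<longleftrightarrow> A' y x"
  by (auto simp: switched_def Let_def A_sym[of x y])

lemma in_cell [simp]: "v i a \<in> cell v i"
  by (rule cases_2[of a]) (simp_all add: cell_def)

lemma card_nbrs_in_cell:
  "card (nbrs_in \<Gamma> (cell v i) x) = of_bool (A x (v i 1)) + of_bool (A x (v i 2))"
proof -
  have "nbrs_in \<Gamma> (cell v i) x =
      (if A x (v i 1) then {v i 1} else {}) \<union> (if A x (v i 2) then {v i 2} else {})"
    by (auto simp: nbrs_in_def cell_def)
  then show ?thesis
    by simp
qed

lemma transversal_iff:
  "x \<in> transversal_vertices \<Gamma> v D \<longleftrightarrow> x \<in> D \<and> (\<forall>i. A x (v i 1) \<noteq> A x (v i 2))"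
  by (auto simp: transversal_vertices_def card_nbrs_in_cell)

text \<open>A cell contains an odd number of neighbours exactly when its two vertices are treated
  differently, and the parity is the same for all cells.\<close>

lemma transversal_or_even:
  assumes "x \<in> D"
  shows "x \<in> transversal_vertices \<Gamma> v D \<or> (\<forall>i. A x (v i 1) = A x (v i 2))"
proof -
  have "(A x (v i 1) = A x (v i 2)) = (A x (v j 1) = A x (v j 2))" for i j
    using parity[OF assms, of i j] by (auto simp: card_nbrs_in_cell cong_def)
  then show ?thesis
    using assms by (auto simp: transversal_iff)
qed

lemma A'_inner: "x \<in> D \<Longrightarrow> y \<in> D \<Longrightarrow> A' x y \<longleftrightarrow> A x y"
  by (auto simp: switched_def Let_def block_removed_def block_added_def outer_removed_def outer_added_def)

lemma A'_outer:
  assumes "x \<in> D"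
  shows "A' x (v i a) \<longleftrightarrow>
    (if x \<in> transversal_vertices \<Gamma> v D then A x (v (i + 1) a) else A x (v i a))"
proof -
  have "v j b \<noteq> x" for j b
    using assms v_notin by metis
  \<comment> \<open>Since \<open>\<pi>\<close> lowers the index by one, the new neighbours in cell
    \<open>i\<close> come from cell \<open>i + 1\<close>.\<close>
  moreover have "(\<exists>j. i = j - 1 \<and> P j) \<longleftrightarrow> P (i + 1)" for P
    by (metis add_diff_cancel_right' diff_add_cancel)
  moreover have "v j b \<notin> transversal_vertices \<Gamma> v D" for j b
    by (simp add: transversal_iff)
  ultimately show ?thesis
    by (auto simp: switched_def Let_def block_removed_def block_added_def
        outer_removed_def outer_added_def)
qed

text \<open>No vertex of a cell is transversal, so only block replacements matter here. The last two
  alternatives are the two orientations of an added edge.\<close>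

lemma A'_cell:
  "A' (v i a) (v j b) \<longleftrightarrow>
    A (v i a) (v j b) \<and> (\<forall>k l. ((i, j), (k, l)) \<notin> replacements c \<and> ((j, i), (k, l)) \<notin> replacements c) \<or>
    (\<exists>k l. ((i, j), (k, l)) \<in> replacements c \<and> A (v k a) (v l b)) \<or>
    (\<exists>k l. ((j, i), (k, l)) \<in> replacements c \<and> A (v k b) (v l a))"
proof -
  have "v j b \<notin> transversal_vertices \<Gamma> v D" for j b
    by (simp add: transversal_iff)
  then show ?thesis
    by (auto simp: switched_def Let_def block_removed_def block_added_def
        outer_removed_def outer_added_def)
qed

lemma A_iff_induced:
  "x \<in> S \<Longrightarrow> y \<in> S \<Longrightarrow> A x y \<longleftrightarrow> {x, y} \<in> induced_edges \<Gamma> S"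
  by (auto simp: induced_edges_def doubleton_eq_iff A_sym[of x y])

section \<open>Block shapes read off from the listed edge sets\<close>

text \<open>Type \<open>f _ e\<close>: \<open>t\<close> is the label of the vertex of cell
  \<open>i\<close> that is joined to both vertices of cell \<open>j\<close>.\<close>

lemma A_row:
  assumes "induced_edges \<Gamma> (cell v i \<union> cell v j) \<in>
      {{{v i 1, v j 1}, {v i 1, v j 2}},
       {{v i 2, v j 1}, {v i 2, v j 2}}}" (is "?I \<in> _") "i \<noteq> j"
  shows "\<exists>t. \<forall>a b. A (v i a) (v j b) \<longleftrightarrow> a = t"
proof -
  note iff = A_iff_induced[of "v i _" "cell v i \<union> cell v j" "v j _"]
    doubleton_eq_iff eq_2_iff \<open>i \<noteq> j\<close> \<open>i \<noteq> j\<close>[symmetric]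
  consider "?I = {{v i 1, v j 1}, {v i 1, v j 2}}" | "?I = {{v i 2, v j 1}, {v i 2, v j 2}}"
    using assms(1) by blast
  then show ?thesis
  proof cases
    case 1
    then show ?thesis
      by (intro exI[of _ 1]) (auto simp: iff)
  next
    case 2
    then show ?thesis
      by (intro exI[of _ 2]) (auto simp: iff)
  qed
qed

lemma A_col:
  assumes "induced_edges \<Gamma> (cell v i \<union> cell v j) \<in>
      {{{v i 1, v j 1}, {v i 2, v j 1}},
       {{v i 1, v j 2}, {v i 2, v j 2}}}" (is "?I \<in> _") "i \<noteq> j"
  shows "\<exists>t. \<forall>a b. A (v i a) (v j b) \<longleftrightarrow> b = t"
proof -
  note iff = A_iff_induced[of "v i _" "cell v i \<union> cell v j" "v j _"]
    doubleton_eq_iff eq_2_iff \<open>i \<noteq> j\<close> \<open>i \<noteq> j\<close>[symmetric]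
  consider "?I = {{v i 1, v j 1}, {v i 2, v j 1}}" | "?I = {{v i 1, v j 2}, {v i 2, v j 2}}"
    using assms(1) by blast
  then show ?thesis
  proof cases
    case 1
    then show ?thesis
      by (intro exI[of _ 1]) (auto simp: iff)
  next
    case 2
    then show ?thesis
      by (intro exI[of _ 2]) (auto simp: iff)
  qed
qed

lemma A_matching:
  assumes "induced_edges \<Gamma> (cell v i \<union> cell v j) \<in>
      {{{v i 1, v j 1}, {v i 2, v j 2}},
       {{v i 1, v j 2}, {v i 2, v j 1}}}" (is "?I \<in> _") "i \<noteq> j"
  shows "\<exists>s. \<forall>a b. A (v i a) (v j b) \<longleftrightarrow> (a = b) = s"
proof -
  note iff = A_iff_induced[of "v i _" "cell v i \<union> cell v j" "v j _"]
    doubleton_eq_iff eq_2_iff \<open>i \<noteq> j\<close> \<open>i \<noteq> j\<close>[symmetric]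
  consider "?I = {{v i 1, v j 1}, {v i 2, v j 2}}" | "?I = {{v i 1, v j 2}, {v i 2, v j 1}}"
    using assms(1) by blast
  then show ?thesis
  proof cases
    case 1
    then show ?thesis
      by (intro exI[of _ True]) (auto simp: iff intro: eq_if_neq_1)
  next
    case 2
    then show ?thesis
      by (intro exI[of _ False]) (auto simp: iff intro: eq_if_neq_1)
  qed
qed

lemma A_complete:
  assumes "induced_edges \<Gamma> (cell v i \<union> cell v j) \<in>
      {{},
       {{v i 1, v j 1}, {v i 1, v j 2}, {v i 2, v j 1}, {v i 2, v j 2}}}" (is "?I \<in> _") "i \<noteq> j"
  shows "\<exists>s. \<forall>a b. A (v i a) (v j b) \<longleftrightarrow> s"
proof -
  note iff = A_iff_induced[of "v i _" "cell v i \<union> cell v j" "v j _"]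
    doubleton_eq_iff eq_2_iff \<open>i \<noteq> j\<close> \<open>i \<noteq> j\<close>[symmetric]
  consider "?I = {}" | "?I = {{v i 1, v j 1}, {v i 1, v j 2}, {v i 2, v j 1}, {v i 2, v j 2}}"
    using assms(1) by blast
  then show ?thesis
  proof cases
    case 1
    then show ?thesis
      by (intro exI[of _ False]) (auto simp: iff)
  next
    case 2
    then show ?thesis
      by (intro exI[of _ True]) (auto simp: iff)
  qed
qed

text \<open>Every edge listed for cells \<open>i\<close> and \<open>i + 2\<close> meets cell
  \<open>i + 2\<close>, which an edge inside cell \<open>i\<close> would not do.\<close>

lemma A_diag: "\<not> A (v i a) (v i b)"
proof -
  have "\<exists>d. v (i + 2) d \<in> e" if "e \<in> induced_edges \<Gamma> (cell v i \<union> cell v (i + 2))" for e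
  proof (cases c)
    case Case_a
    show ?thesis
      using that spec[OF condition[unfolded Case_a switching_condition.simps Let_def], of i] by auto
  next
    case Case_b
    show ?thesis
      using that spec[OF condition[unfolded Case_b switching_condition.simps Let_def], of i] by auto
  next
    case Case_c
    show ?thesis
      using that spec[OF condition[unfolded Case_c switching_condition.simps Let_def], of i] by auto
  qed
  then show ?thesis
    using A_iff_induced[of "v i a" "cell v i \<union> cell v (i + 2)" "v i b"] by fastforce
qed

lemma A'_diag: "\<not> A' (v i a) (v i b)"
  unfolding A'_cell by (cases c) (simp_all add: A_diag)

text \<open>The shape lemmas give one parameter per index, collected into functions by choice. The
  descriptions of the new blocks then come from \<open>A'_cell\<close>.\<close>

lemma blocks: "blocks_intertwined (\<lambda>i a j b. A (v i a) (v j b)) (\<lambda>i a j b. A' (v i a) (v j b))"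
proof (cases c)
  case Case_a
  have "\<exists>s. \<forall>a b. A (v i a) (v (i + 1) b) \<longleftrightarrow> s" "\<exists>t. \<forall>a b. A (v i a) (v (i + 2) b) \<longleftrightarrow> a = t" for i
    using condition A_complete[of i "i + 1"] A_row[of i "i + 2"] by (simp_all add: Case_a Let_def)
  then obtain s t where st: "\<And>i a b. A (v i a) (v (i + 1) b) \<longleftrightarrow> s i"
      "\<And>i a b. A (v i a) (v (i + 2) b) \<longleftrightarrow> a = t i"
    by metis
  show ?thesis
    by (rule blocks_intertwined_case_a[where c = s and t = t], rule A_diag, rule A'_diag, rule A_sym,
        rule A'_sym, rule st(1), rule st(2)) (simp_all add: A'_cell[unfolded Case_a] Case_a)
next
  case Case_b
  have "\<exists>s. \<forall>a b. A (v i a) (v (i + 1) b) \<longleftrightarrow> (a = b) = s" "\<exists>t. \<forall>a b. A (v i a) (v (i + 2) b) \<longleftrightarrow> a = t" for i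
    using condition A_matching[of i "i + 1"] A_row[of i "i + 2"] by (simp_all add: Case_b Let_def)
  then obtain s t where st: "\<And>i a b. A (v i a) (v (i + 1) b) \<longleftrightarrow> (a = b) = s i"
      "\<And>i a b. A (v i a) (v (i + 2) b) \<longleftrightarrow> a = t i"
    by metis
  show ?thesis
    by (rule blocks_intertwined_case_b[where c = s and t = t], rule A_diag, rule A'_diag, rule A_sym,
        rule A'_sym, rule st(1), rule st(2)) (simp_all add: A'_cell[unfolded Case_b] Case_b)
next
  case Case_c
  have "\<exists>t. \<forall>a b. A (v i a) (v (i + 1) b) \<longleftrightarrow> a = t" "\<exists>u. \<forall>a b. A (v i a) (v (i + 2) b) \<longleftrightarrow> b = u" for i
    using condition A_row[of i "i + 1"] A_col[of i "i + 2"] by (simp_all add: Case_c Let_def)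
  then obtain t u where st: "\<And>i a b. A (v i a) (v (i + 1) b) \<longleftrightarrow> a = t i"
      "\<And>i a b. A (v i a) (v (i + 2) b) \<longleftrightarrow> b = u i"
    by metis
  show ?thesis
    by (rule blocks_intertwined_case_c[where t = t and u = u], rule A_diag, rule A'_diag, rule A_sym,
        rule A'_sym, rule st(1), rule st(2)) (simp_all add: A'_cell[unfolded Case_c] Case_c)
qed

lemma R_cospectral_switched:
  assumes "pverts \<Gamma> = V"
  shows "R_cospectral \<Gamma> (switched c \<Gamma> v D)"
proof (rule R_cospectral_if_intertwined[where Q = Q], unfold assms)
  \<comment> \<open>The constant vector 1 has mean 1 and no alternating part on any cell, so
    \<open>Q\<close> fixes it from either side.\<close>
  show "(\<Sum>y\<in>V. Q x y) = 1" if "x \<in> V" for x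
    using that sum_Q_left_v[of _ _ "\<lambda>_. 1"] sum_Q_left_D[of _ "\<lambda>_. 1"]
    by (cases x rule: V_cases) (simp_all add: avg_def)
  show "(\<Sum>y\<in>V. Q y z) = 1" if "z \<in> V" for z
    using that sum_Q_right_v[of "\<lambda>_. 1"] sum_Q_right_D[of _ "\<lambda>_. 1"]
    by (cases z rule: V_cases) (simp_all add: avg_def)
  show "(\<Sum>y\<in>V. of_bool (A x y) * Q y z) = (\<Sum>y\<in>V. Q x y * of_bool (A' y z))"
    if "x \<in> V" "z \<in> V" for x z
    \<comment> \<open>The placeholder leaves open only the dichotomy for vertices of
      \<open>D\<close>.\<close>
    using A_sym A'_sym A'_inner _ blocks that
  proof (rule intertwined_if_blocks)
    show "(\<forall>i. A x (v i 1) = A x (v i 2)) \<and> (\<forall>i a. A' x (v i a) = A x (v i a)) \<or>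
        (\<forall>i. A x (v i 1) \<noteq> A x (v i 2)) \<and> (\<forall>i a. A' x (v i a) = A x (v (i + 1) a))" if "x \<in> D" for x
      using transversal_or_even[OF that] transversal_iff[of x] by (auto simp: A'_outer[OF that])
  qed
qed (simp_all add: Q_orth assms)

end

theorem corollary9:
  fixes \<Gamma> :: "'a pair_pre_digraph"
    and v :: "5 \<Rightarrow> 2 \<Rightarrow> 'a"
    and D :: "'a set"
    and c :: switching_case
  assumes graph: "pair_graph \<Gamma>"
    and cover: "pverts \<Gamma> = (\<Union>i. cell v i) \<union> D"
    and disjoint: "\<And>i j. i \<noteq> j \<Longrightarrow> cell v i \<inter> cell v j = {}"
    and disjoint_D: "\<And>i. cell v i \<inter> D = {}"
    and card_cell: "\<And>i. card (cell v i) = 2"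
    and parity: "\<And>x i j. x \<in> D \<Longrightarrow>
      [card (nbrs_in \<Gamma> (cell v i) x) = card (nbrs_in \<Gamma> (cell v j) x)] (mod 2)"
    and condition: "switching_condition c \<Gamma> v"
  shows "R_cospectral \<Gamma> (switched c \<Gamma> v D)"
proof -
  interpret pair_graph \<Gamma>
    by (rule graph)
  have cell_eq: "cell v i = range (v i)" for i
    by (simp add: cell_def UNIV_2)
  have inj: "v i 1 \<noteq> v i 2" for i
    using card_cell[of i] by (auto simp: cell_def)
  have "v i a = v j b \<longleftrightarrow> i = j \<and> a = b" for i j a b
  proof
    assume eq: "v i a = v j b"
    then have "i = j"
      using disjoint[of i j] by (auto simp: cell_eq)
    then show "i = j \<and> a = b"
      using eq inj[of i] by (cases a rule: cases_2; cases b rule: cases_2) auto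
  qed simp
  moreover have "v i a \<notin> D" for i a
    using disjoint_D[of i] by (auto simp: cell_eq)
  moreover have "finite D"
    using cover pair_finite_verts by simp
  ultimately interpret switching \<Gamma> v D c
    using parity condition by unfold_locales auto
  have "pverts \<Gamma> = V"
    using cover by (auto simp: cell_eq)
  then show ?thesis
    by (rule R_cospectral_switched)
qed

end
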